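(* Let $\mathcal{H}$ be a Hilbert space, $\mathcal{C}_1,\mathcal{C}_2\subset\mathcal{H}$ be closed, convex, nonempty sets and $\bm x\in\mathcal{C}_1\cap\mathcal{C}_2$. Let $\bm v\in N_{\mathcal{C}_1\cap\mathcal{C}_2}(\bm x)$ and consider the two optimization problems with optimal values, respectively, $p^*$ and $d^*$: $$p^*=-\delta^*_{\mathcal{C}_1\cap\mathcal{C}_2}(\bm v)=\inf_{\bm c\in\mathcal{H}}\left(\delta_{\mathcal{C}_1}(\bm c)+\delta_{\mathcal{C}_2}(\bm c)-\langle\bm v,\bm c\rangle\right),$$ $$d^*=-\inf_{\bm y\in\mathcal{H}}\left(\delta^*_{\mathcal{C}_1}(\bm y)+\delta^*_{\mathcal{C}_2}(\bm v-\bm y)\right)=\sup_{\bm y\in\mathcal{H}}\left(-\delta^*_{\mathcal{C}_1}(\bm y)-\delta^*_{\mathcal{C}_2}(\bm v-\bm y)\right).$$ Then $$\bm v\in N_{\mathcal{C}_1}(\bm x)+N_{\mathcal{C}_2}(\bm x)$$ if and only if strong duality holds, i.e. $p^*=d^*$ and the optimal value $d^*$ is achieved (in the supremum defining $d^*$) at some $\bm y^*\in\mathcal{H}$.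
   Context: $\mathcal{H}$ is real. For a closed convex nonempty set $\mathcal{C}\subset\mathcal{H}$ and $\bm x\in\mathcal{C}$, the outward normal cone is $N_{\mathcal C}(\bm x)=\{\bm y\in\mathcal{H}:\langle\bm y,\bm c-\bm x\rangle\le0\text{ for all }\bm c\in\mathcal{C}\}$. The indicator function $\delta_{\mathcal C}:\mathcal{H}\to\mathbb{R}\cup\{+\infty\}$ is $0$ on $\mathcal{C}$ and $+\infty$ outside $\mathcal{C}$. The support function is $\delta^*_{\mathcal C}(\bm y)=\sup_{\bm x\in\mathcal{C}}\langle\bm y,\bm x\rangle\in\mathbb{R}\cup\{+\infty\}$. *)

theory Defs
  imports "HOL-Analysis.Analysis" "HOL-Library.Set_Algebras"
begin

(* The intended use is x in C; the formula itself does not enforce this. *)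
definition normal_cone :: "'a::real_inner set \<Rightarrow> 'a \<Rightarrow> 'a set" where
  "normal_cone C x = {y. \<forall>c\<in>C. y \<bullet> (c - x) \<le> 0}"

(* The indicator function of convex analysis (0 on C, infinity outside),
   not the 0-1 valued library constant "indicator". *)
definition indicator_fun :: "'a set \<Rightarrow> 'a \<Rightarrow> ereal" where
  "indicator_fun C x = (if x \<in> C then 0 else \<infinity>)"

(* For nonempty C the value is never -\<infinity>, so sums of support functions
   avoid the convention \<infinity> + (-\<infinity>) = \<infinity> of ereal. *)
definition support_fun :: "'a::real_inner set \<Rightarrow> 'a \<Rightarrow> ereal" where
  "support_fun C y = (SUP x\<in>C. ereal (y \<bullet> x))"

end

theory Submission
  imports Defs
begin

text \<open>Since \<open>v\<close> is normal to \<open>C\<^sub>1 \<inter> C\<^sub>2\<close> at \<open>x\<close>, the primal value is \<open>- \<langle>v, x\<rangle>\<close>. Every point \<open>y\<close>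
  has dual value at most \<open>- \<langle>v, x\<rangle>\<close>, as \<open>\<langle>y, x\<rangle>\<close> and \<open>\<langle>v - y, x\<rangle>\<close> bound the two support
  functions from below. Equality holds exactly when both bounds are tight, i.e. when
  \<open>y \<in> normal_cone C\<^sub>1 x\<close> and \<open>v - y \<in> normal_cone C\<^sub>2 x\<close>, so the decompositions of \<open>v\<close> along the two normal
  cones are the dual solutions with zero duality gap.\<close>

lemma inner_le_support_fun: "x \<in> C \<Longrightarrow> ereal (y \<bullet> x) \<le> support_fun C y"
  unfolding support_fun_def by (rule SUP_upper)

lemma support_fun_neq_minf:
  assumes "x \<in> C"
  shows "support_fun C y \<noteq> - \<infinity>"
  using inner_le_support_fun[OF assms, of y] by auto

text \<open>Turns cone membership into an \<open>ereal\<close> inequality, open to case analysis on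
  the support value.\<close>

lemma support_fun_le_inner_iff_normal_cone:
  "support_fun C y \<le> ereal (y \<bullet> x) \<longleftrightarrow> y \<in> normal_cone C x"
  by (simp add: support_fun_def normal_cone_def SUP_le_iff inner_diff_right)

lemma support_fun_eq_inner:
  assumes "x \<in> C" "y \<in> normal_cone C x"
  shows "support_fun C y = ereal (y \<bullet> x)"
  using assms by (simp add: antisym inner_le_support_fun support_fun_le_inner_iff_normal_cone)

text \<open>Outside \<open>A \<inter> B\<close> the objective is \<infinity>, so such points do not
  affect the infimum.\<close>

lemma INF_indicator_fun_minus_inner:
  "(INF c. indicator_fun A c + indicator_fun B c - ereal (v \<bullet> c)) = - support_fun (A \<inter> B) v"
proof -
  have "(INF c. indicator_fun A c + indicator_fun B c - ereal (v \<bullet> c))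
      = (INF c\<in>A \<inter> B. - ereal (v \<bullet> c))"
  proof (rule antisym)
    show "(INF c. indicator_fun A c + indicator_fun B c - ereal (v \<bullet> c))
        \<le> (INF c\<in>A \<inter> B. - ereal (v \<bullet> c))"
      by (rule INF_mono) (auto simp: indicator_fun_def)
    show "(INF c\<in>A \<inter> B. - ereal (v \<bullet> c))
        \<le> (INF c. indicator_fun A c + indicator_fun B c - ereal (v \<bullet> c))"
    proof (rule INF_greatest)
      fix c
      show "(INF c\<in>A \<inter> B. - ereal (v \<bullet> c)) \<le> indicator_fun A c + indicator_fun B c - ereal (v \<bullet> c)"
      proof (cases "c \<in> A \<inter> B")
        case True
        then have "(INF c\<in>A \<inter> B. - ereal (v \<bullet> c)) \<le> - ereal (v \<bullet> c)"
          by (rule INF_lower)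
        with True show ?thesis
          by (simp add: indicator_fun_def)
      next
        case False
        then show ?thesis
          by (auto simp: indicator_fun_def)
      qed
    qed
  qed
  then show ?thesis
    by (simp only: support_fun_def ereal_INF_uminus_eq)
qed

text \<open>Nonemptiness matters: for an empty set the support function is \<open>-\<infinity>\<close>, and
  negation does not distribute over the \<^typ>\<open>ereal\<close> sum \<open>\<infinity> + (-\<infinity>)\<close>.\<close>

lemma SUP_dual_eq_uminus_INF:
  assumes "A \<noteq> {}" "B \<noteq> {}"
  shows "(SUP y. - support_fun A y - support_fun B (v - y))
    = - (INF y. support_fun A y + support_fun B (v - y))"
proof -
  obtain a b where "a \<in> A" "b \<in> B"
    using assms by auto
  then have "- support_fun A y - support_fun B (v - y) = - (support_fun A y + support_fun B (v - y))" for y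
    using support_fun_neq_minf[of a A y] support_fun_neq_minf[of b B "v - y"]
    by (cases "support_fun A y"; cases "support_fun B (v - y)") auto
  then show ?thesis
    by (simp add: ereal_SUP_uminus_eq)
qed

text \<open>Weak duality: the two lower bounds at \<open>x\<close> add up to
  \<open>v \<bullet> x\<close>.\<close>

lemma dual_value_le:
  assumes "x \<in> A \<inter> B"
  shows "- support_fun A y - support_fun B (v - y) \<le> - ereal (v \<bullet> x)"
  using inner_le_support_fun[of x A y] inner_le_support_fun[of x B "v - y"] assms
  by (cases "support_fun A y"; cases "support_fun B (v - y)") (auto simp: inner_diff_left)

lemma dual_value_eq_iff:
  assumes "x \<in> A \<inter> B"
  shows "- support_fun A y - support_fun B (v - y) = - ereal (v \<bullet> x)
    \<longleftrightarrow> y \<in> normal_cone A x \<and> v - y \<in> normal_cone B x"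
  unfolding support_fun_le_inner_iff_normal_cone[symmetric]
  using inner_le_support_fun[of x A y] inner_le_support_fun[of x B "v - y"] assms
  \<comment> \<open>The lower bounds exclude -\<infinity>. If a support value is \<infinity>, the
    dual value is -\<infinity> and a cone membership fails, so both sides are false.\<close>
  by (cases "support_fun A y"; cases "support_fun B (v - y)") (auto simp: inner_diff_left)

theorem proposition6p2:
  fixes C\<^sub>1 C\<^sub>2 :: "'a::{real_inner, complete_space} set"
    and x v :: 'a
    and p d :: ereal
  assumes "closed C\<^sub>1" "convex C\<^sub>1" "C\<^sub>1 \<noteq> {}"
    and "closed C\<^sub>2" "convex C\<^sub>2" "C\<^sub>2 \<noteq> {}"
    and "x \<in> C\<^sub>1 \<inter> C\<^sub>2"
    and "v \<in> normal_cone (C\<^sub>1 \<inter> C\<^sub>2) x"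
    and p_def: "p = (INF c. indicator_fun C\<^sub>1 c + indicator_fun C\<^sub>2 c - ereal (v \<bullet> c))"
    and d_def: "d = (SUP y. - support_fun C\<^sub>1 y - support_fun C\<^sub>2 (v - y))"
  shows "p = - support_fun (C\<^sub>1 \<inter> C\<^sub>2) v \<and>
    d = - (INF y. support_fun C\<^sub>1 y + support_fun C\<^sub>2 (v - y)) \<and>
    (v \<in> normal_cone C\<^sub>1 x + normal_cone C\<^sub>2 x \<longleftrightarrow>
      p = d \<and> (\<exists>y. - support_fun C\<^sub>1 y - support_fun C\<^sub>2 (v - y) = d))"
proof -
  let ?g = "\<lambda>y. - support_fun C\<^sub>1 y - support_fun C\<^sub>2 (v - y)"
  have p: "p = - support_fun (C\<^sub>1 \<inter> C\<^sub>2) v"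
    unfolding p_def by (rule INF_indicator_fun_minus_inner)
  then have px: "p = - ereal (v \<bullet> x)"
    using support_fun_eq_inner[OF assms(7,8)] by simp
  have cone_sum_iff: "v \<in> normal_cone C\<^sub>1 x + normal_cone C\<^sub>2 x \<longleftrightarrow> (\<exists>y. ?g y = p)"
  proof -
    have "v \<in> normal_cone C\<^sub>1 x + normal_cone C\<^sub>2 x
        \<longleftrightarrow> (\<exists>y. y \<in> normal_cone C\<^sub>1 x \<and> v - y \<in> normal_cone C\<^sub>2 x)"
      by (force simp: set_plus_def)
    then show ?thesis
      unfolding px dual_value_eq_iff[OF assms(7)] .
  qed
  \<comment> \<open>By weak duality, a single dual point with value \<open>p\<close> closes the gap
    and is itself a maximiser.\<close>
  have "p = d" if "?g y = p" for y
  proof (rule antisym)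
    show "p \<le> d"
      unfolding d_def by (subst that[symmetric]) (rule SUP_upper, simp)
    show "d \<le> p"
      unfolding d_def px by (rule SUP_least) (rule dual_value_le[OF assms(7)])
  qed
  then have "(\<exists>y. ?g y = p) \<longleftrightarrow> p = d \<and> (\<exists>y. ?g y = d)"
    by auto
  with p cone_sum_iff SUP_dual_eq_uminus_INF[OF assms(3,6)] show ?thesis
    unfolding d_def by blast
qed

end
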